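(* Let $N\ge1$ be an integer. As a function of the complex variable $z$, $F_N(z)$ is meromorphic on $\mathbb{C}$, and its singularities are simple poles at the points $\pm e^{-i\pi/4}t_k$, $k=N+1,N+2,\ldots$. In particular, $F_N$ is analytic in the strip $|\mathrm{Im}(z)|<A_N/\sqrt2$ and in the first and third quadrants of the complex plane.
   Context: For an integer $N\ge1$ put $A_N:=\sqrt{(N+1/2)\pi}$ and $t_k:=\frac{(k-1/2)\pi}{\sqrt{(N+1/2)\pi}}$ for integers $k\ge1$ (so $A_N=t_{N+1}$), and define $$F_N(z):=\frac{1}{\exp\left(2A_Nze^{-i\pi/4}\right)+1}+\frac{z}{A_N}e^{i(z^2+\pi/4)}\sum_{k=1}^N\frac{e^{-t_k^2}}{z^2+it_k^2}.$$ Removable singularities of this expression are understood to be removed (i.e. $F_N$ denotes the analytic extension across them). *)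

theory Defs
  imports "HOL-Complex_Analysis.Complex_Analysis"
begin

definition A_N :: "nat \<Rightarrow> real" where
  "A_N N = sqrt ((real N + 1/2) * pi)"

definition t_k :: "nat \<Rightarrow> nat \<Rightarrow> real" where
  "t_k N k = (real k - 1/2) * pi / sqrt ((real N + 1/2) * pi)"

(* The displayed expression for F_N. At a zero of one of its denominators the value is
   an artefact of division by zero; F_N below does not depend on it. *)
definition F_expr :: "nat \<Rightarrow> complex \<Rightarrow> complex" where
  "F_expr N z =
     1 / (exp (2 * of_real (A_N N) * z * exp (- (\<i> * of_real pi / 4))) + 1)
     + z / of_real (A_N N) * exp (\<i> * (z ^ 2 + of_real pi / 4))
       * (\<Sum>k = 1..N. of_real (exp (- ((t_k N k) ^ 2))) / (z ^ 2 + \<i> * of_real ((t_k N k) ^ 2)))"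

(* remove_sings takes the limit of the expression wherever a finite limit exists, and
   the dummy value 0 at the other points (here the poles). *)
definition F_N :: "nat \<Rightarrow> complex \<Rightarrow> complex" where
  "F_N N = remove_sings (F_expr N)"

definition pole_points :: "nat \<Rightarrow> complex set" where
  "pole_points N = {z. \<exists>k \<ge> N + 1.
     z = exp (- (\<i> * of_real pi / 4)) * of_real (t_k N k) \<or>
     z = - (exp (- (\<i> * of_real pi / 4)) * of_real (t_k N k))}"

end

theory Submission
  imports Defs
begin

text \<open>
  Both summands of \<^term>\<open>F_expr N\<close> are meromorphic, so everything is decided by the limits of
  \<open>(z - z0) * F_expr N z\<close> as \<open>z\<close> tends to \<open>z0\<close>: if such a limit is \<open>0\<close>, the singularity is
  removable, and otherwise it is the residue at a simple pole
  (\<open>remove_sings_analytic_of_lim_0\<close>, \<open>simple_pole_of_lim\<close>).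

  Write \<open>rot = exp (- \<i> pi / 4)\<close>, so that \<open>rot^2 = - \<i>\<close>, and \<open>A\<close> for \<^term>\<open>A_N N\<close>.
  The equation \<open>exp (2 A z rot) = - 1\<close> means that \<open>2 A z rot\<close> is an odd multiple of \<open>\<i> pi\<close>; squaring,
  this is \<open>z^2 + \<i> t^2 = 0\<close> for some \<open>t = t_k N k\<close> with \<open>k \<ge> 1\<close> (\<open>exp_denominator_zero_iff\<close>).
  Thus the denominators of the finite sum vanish exactly at those zeros of the exponential
  denominator that have \<open>k \<le> N\<close>. The first summand has the residue \<open>- 1 / (2 A rot)\<close> at
  each of its poles. At a point with \<open>z^2 = - \<i> t^2\<close> and \<open>k \<le> N\<close>, the factor
  \<open>exp (\<i> z^2) = exp (t^2)\<close> compensates the weight \<open>exp (- t^2)\<close>, and since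
  \<open>exp (\<i> pi / 4) = 1 / rot\<close> the finite sum contributes \<open>1 / (2 A rot)\<close>. Hence the two residues cancel
  for \<open>k \<le> N\<close>, and for \<open>k > N\<close> the first one survives (\<open>F_expr_residue\<close>).

  The positions of the poles also follow from \<open>z^2 = - \<i> t^2\<close>: comparing real and imaginary parts
  gives \<open>Re z * Im z < 0\<close> and \<open>2 (Im z)^2 = t^2 \<ge> A^2\<close>, which keeps them outside the strip
  and the two quadrants.
\<close>

section \<open>Singularities of order at most one\<close>

text \<open>The finite limit makes the singularity of \<open>(z - z0) * f z\<close> removable. Both criteria below read
  off the behaviour of \<open>f\<close> from the analytic extension \<open>g\<close> of this product.\<close>

lemma simple_pole_factor:
  fixes f :: "complex \<Rightarrow> complex"
  assumes mero: "f meromorphic_on {z0}"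
    and lim: "((\<lambda>z. (z - z0) * f z) \<longlongrightarrow> c) (at z0)"
  obtains g where "g analytic_on {z0}" "g z0 = c"
    "eventually (\<lambda>z. f z = g z / (z - z0)) (at z0)"
proof
  let ?p = "\<lambda>z. (z - z0) * f z"
  have "?p meromorphic_on {z0}"
    using mero by (intro meromorphic_intros) auto
  then have iso: "isolated_singularity_at ?p z0"
    by (simp add: meromorphic_on_isolated_singularity)
  show "remove_sings ?p analytic_on {z0}"
    by (rule remove_sings_analytic_at[OF iso lim])
  show "remove_sings ?p z0 = c"
    by (rule remove_sings_eqI[OF lim])
  have "eventually (\<lambda>z. z \<noteq> z0) (at z0)"
    by (simp add: eventually_at_filter)
  with eventually_remove_sings_eq_at[OF iso]
  show "eventually (\<lambda>z. f z = remove_sings ?p z / (z - z0)) (at z0)"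
    by eventually_elim simp
qed

lemma simple_pole_of_lim:
  fixes f :: "complex \<Rightarrow> complex"
  assumes mero: "f meromorphic_on {z0}"
    and lim: "((\<lambda>z. (z - z0) * f z) \<longlongrightarrow> c) (at z0)" and "c \<noteq> 0"
  shows "is_pole f z0" and "zorder f z0 = -1"
proof -
  obtain g where g: "g analytic_on {z0}" "g z0 = c"
    "eventually (\<lambda>z. f z = g z / (z - z0)) (at z0)"
    using simple_pole_factor[OF mero lim] by blast
  obtain S where S: "open S" "z0 \<in> S" "g holomorphic_on S"
    using g(1) by (auto simp: analytic_at)
  have "is_pole (\<lambda>z. g z / (z - z0)) z0"
    using is_pole_basic[of g S z0 1] S g(2) \<open>c \<noteq> 0\<close> by simp
  then show "is_pole f z0"
    using is_pole_cong[OF g(3) refl] by simp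
  have "zorder (\<lambda>z. g z / (z - z0)) z0 = -1"
    using zorder_nonzero_div_power[of S z0 g 1] S g(2) \<open>c \<noteq> 0\<close> by simp
  then show "zorder f z0 = -1"
    using zorder_cong[OF g(3) refl] by simp
qed

text \<open>Riemann's removable singularity theorem under its weak hypothesis \<open>f z = o(1 / (z - z0))\<close>:
  the extension \<open>g\<close> of \<open>(z - z0) * f z\<close> vanishes at \<open>z0\<close>, so \<open>f\<close> tends to
  the derivative of \<open>g\<close>.\<close>

lemma remove_sings_analytic_of_lim_0:
  fixes f :: "complex \<Rightarrow> complex"
  assumes mero: "f meromorphic_on {z0}"
    and lim: "((\<lambda>z. (z - z0) * f z) \<longlongrightarrow> 0) (at z0)"
  shows "remove_sings f analytic_on {z0}"
proof -
  obtain g where g: "g analytic_on {z0}" "g z0 = 0"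
    "eventually (\<lambda>z. f z = g z / (z - z0)) (at z0)"
    using simple_pole_factor[OF mero lim] by blast
  have "(g has_field_derivative deriv g z0) (at z0)"
    using g(1) analytic_on_imp_differentiable_at DERIV_deriv_iff_field_differentiable by blast
  then have "((\<lambda>z. g z / (z - z0)) \<longlongrightarrow> deriv g z0) (at z0)"
    using g(2) by (simp add: has_field_derivative_iff)
  then have "(f \<longlongrightarrow> deriv g z0) (at z0)"
    using tendsto_cong[OF g(3)] by simp
  then show ?thesis
    using remove_sings_analytic_at mero meromorphic_on_isolated_singularity by blast
qed

lemma residue_lim_inverse:
  fixes D :: "complex \<Rightarrow> complex"
  assumes der: "(D has_field_derivative D') (at z0)" and "D z0 = 0 \<Longrightarrow> D' \<noteq> 0"
  shows "((\<lambda>z. (z - z0) * (1 / D z)) \<longlongrightarrow> (if D z0 = 0 then 1 / D' else 0)) (at z0)"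
proof (cases "D z0 = 0")
  case True
  have "((\<lambda>z. D z / (z - z0)) \<longlongrightarrow> D') (at z0)"
    using der True by (simp add: has_field_derivative_iff)
  then have "((\<lambda>z. inverse (D z / (z - z0))) \<longlongrightarrow> inverse D') (at z0)"
    using assms(2) True by (intro tendsto_inverse) auto
  then show ?thesis
    using True by (simp add: field_simps)
next
  case False
  have "(D \<longlongrightarrow> D z0) (at z0)"
    using DERIV_isCont[OF der] by (simp add: isCont_def)
  then have "((\<lambda>z. (z - z0) * (1 / D z)) \<longlongrightarrow> (z0 - z0) * (1 / D z0)) (at z0)"
    using False by (intro tendsto_intros)
  then show ?thesis
    using False by simp
qed

section \<open>Zeros of the denominators\<close>

abbreviation rot :: complex where
  "rot \<equiv> exp (- (\<i> * of_real pi / 4))"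

lemma rot_sq: "rot ^ 2 = - \<i>"
proof -
  have "rot ^ 2 = exp (- (\<i> * of_real (pi / 2)))"
    by (simp flip: exp_double add: field_simps)
  also have "\<dots> = - \<i>"
    unfolding exp_minus cis_conv_exp[symmetric] by simp
  finally show ?thesis .
qed

lemma exp_quarter_pi: "exp (\<i> * of_real pi / 4) = 1 / rot"
  using exp_minus_inverse[of "\<i> * of_real pi / 4"]
  by (simp only: nonzero_eq_divide_eq exp_not_eq_zero not_False_eq_True)

lemma A_N_pos: "A_N N > 0"
  by (simp add: A_N_def add_nonneg_pos)

lemma t_k_eq: "t_k N k = (real k - 1/2) * pi / A_N N"
  by (simp add: t_k_def A_N_def)

lemma t_k_pos: "k \<ge> 1 \<Longrightarrow> t_k N k > 0"
  by (simp add: t_k_eq A_N_pos)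

lemma t_k_mono: "j \<le> k \<Longrightarrow> t_k N j \<le> t_k N k"
  using A_N_pos[of N] by (simp add: t_k_eq divide_right_mono)

lemma A_N_eq_t_k: "A_N N = t_k N (N + 1)"
proof -
  have "A_N N * A_N N = (real N + 1/2) * pi"
    by (simp add: A_N_def)
  then show ?thesis
    using A_N_pos[of N] by (simp add: t_k_eq field_simps)
qed

lemma t_k_sq_inj:
  assumes "j \<ge> 1" "k \<ge> 1" "(t_k N j)^2 = (t_k N k)^2"
  shows "j = k"
proof -
  have "t_k N j = t_k N k"
    using assms t_k_pos[of j N] t_k_pos[of k N] by (simp add: power2_eq_iff)
  then show ?thesis
    using A_N_pos[of N] by (simp add: t_k_eq)
qed

lemma sum_denominator_zero_iff:
  "z ^ 2 + \<i> * of_real (t ^ 2) = 0 \<longleftrightarrow> z = rot * of_real t \<or> z = - (rot * of_real t)"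
proof -
  have "(rot * of_real t)^2 = - (\<i> * of_real (t ^ 2))"
    by (simp add: power_mult_distrib rot_sq)
  then have "z ^ 2 + \<i> * of_real (t ^ 2) = 0 \<longleftrightarrow> z ^ 2 = (rot * of_real t)^2"
    by (simp add: add_eq_0_iff2)
  then show ?thesis
    by (simp only: power2_eq_iff)
qed

lemma pole_points_eq: "pole_points N = {z. \<exists>k \<ge> N + 1. z ^ 2 + \<i> * of_real ((t_k N k) ^ 2) = 0}"
  unfolding pole_points_def sum_denominator_zero_iff ..

text \<open>The squared form turns the integer index of the odd multiples of \<open>\<i> pi\<close> into a
  positive natural number, and it matches the denominators \<open>z^2 + \<i> t^2\<close> of the finite sum.\<close>

lemma exp_eq_minus_1_iff:
  fixes u :: complex
  shows "exp u = -1 \<longleftrightarrow> (\<exists>k\<ge>1::nat. u ^ 2 = - of_real (((2 * real k - 1) * pi) ^ 2))"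
proof
  assume "exp u = -1"
  then have "exp u = exp (\<i> * of_real pi)"
    by simp
  then obtain n :: int where "u = \<i> * of_real pi + of_real (of_int (2 * n) * pi) * \<i>"
    unfolding exp_eq by auto
  then have n: "u = \<i> * of_real ((2 * of_int n + 1) * pi)"
    by (simp add: algebra_simps)
  \<comment> \<open>The odd number \<open>2 n + 1\<close> is \<open>2 k - 1\<close> up to sign, which squaring forgets.\<close>
  define k where "k = (if n \<ge> 0 then nat (n + 1) else nat (- n))"
  have "real k = (if n \<ge> 0 then of_int n + 1 else - of_int n)"
    by (auto simp: k_def)
  then have "((2 * real k - 1) * pi) ^ 2 = ((2 * of_int n + 1) * pi) ^ 2"
    by (auto simp: power2_eq_square algebra_simps)
  then have "u ^ 2 = - of_real (((2 * real k - 1) * pi) ^ 2)"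
    unfolding n by (simp add: power_mult_distrib)
  moreover have "k \<ge> 1"
    by (auto simp: k_def)
  ultimately show "\<exists>k\<ge>1::nat. u ^ 2 = - of_real (((2 * real k - 1) * pi) ^ 2)"
    by blast
next
  assume "\<exists>k\<ge>1::nat. u ^ 2 = - of_real (((2 * real k - 1) * pi) ^ 2)"
  then obtain k :: nat where k: "u ^ 2 = (\<i> * of_real ((2 * real k - 1) * pi)) ^ 2"
    by (auto simp: power_mult_distrib)
  have "exp (\<i> * of_real ((2 * real k - 1) * pi))
      = exp (\<i> * of_real pi + of_real (of_int (2 * (int k - 1)) * pi) * \<i>)"
    by (simp add: algebra_simps)
  also have "\<dots> = exp (\<i> * of_real pi)"
    unfolding exp_eq by blast
  finally have e: "exp (\<i> * of_real ((2 * real k - 1) * pi)) = -1"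
    by simp
  then have "exp (- (\<i> * of_real ((2 * real k - 1) * pi))) = -1"
    unfolding exp_minus by simp
  with e k show "exp u = -1"
    unfolding power2_eq_iff by metis
qed

lemma exp_denominator_zero_iff:
  "exp (2 * of_real (A_N N) * z * rot) + 1 = 0
    \<longleftrightarrow> (\<exists>k\<ge>1. z ^ 2 + \<i> * of_real ((t_k N k) ^ 2) = 0)"
proof -
  let ?A = "complex_of_real (A_N N)"
  have A: "?A \<noteq> 0"
    using A_N_pos[of N] by simp
  have "(2 * ?A * z * rot) ^ 2 = - of_real (((2 * real k - 1) * pi) ^ 2)
      \<longleftrightarrow> z ^ 2 + \<i> * of_real ((t_k N k) ^ 2) = 0" for k
  proof -
    have "(2 * real k - 1) * pi = 2 * A_N N * t_k N k"
      using A_N_pos[of N] by (simp add: t_k_eq field_simps)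
    then have "(2 * ?A * z * rot) ^ 2 + of_real (((2 * real k - 1) * pi) ^ 2)
        = (2 * ?A) ^ 2 * (- \<i>) * (z ^ 2 + \<i> * of_real ((t_k N k) ^ 2))"
      by (simp add: power_mult_distrib rot_sq algebra_simps)
    then show ?thesis
      using A by (auto simp: eq_neg_iff_add_eq_0)
  qed
  then show ?thesis
    using exp_eq_minus_1_iff[of "2 * ?A * z * rot"] by (simp add: add_eq_0_iff2)
qed

section \<open>Residues and their cancellation\<close>

lemma F_expr_meromorphic: "F_expr N meromorphic_on S"
  unfolding F_expr_def
  by (intro meromorphic_intros) (auto intro!: analytic_on_imp_meromorphic_on analytic_intros)

lemma exp_summand_lim:
  fixes N z0
  defines "c \<equiv> 2 * of_real (A_N N) * rot"
  shows "((\<lambda>z. (z - z0) * (1 / (exp (2 * of_real (A_N N) * z * rot) + 1)))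
    \<longlongrightarrow> (if exp (2 * of_real (A_N N) * z0 * rot) + 1 = 0 then - 1 / c else 0)) (at z0)"
proof -
  have "((\<lambda>z. exp (2 * of_real (A_N N) * z * rot) + 1) has_field_derivative
      exp (2 * of_real (A_N N) * z0 * rot) * c) (at z0)"
    unfolding c_def by (auto intro!: derivative_eq_intros)
  moreover have "c \<noteq> 0"
    using A_N_pos[of N] by (simp add: c_def)
  ultimately have "((\<lambda>z. (z - z0) * (1 / (exp (2 * of_real (A_N N) * z * rot) + 1)))
    \<longlongrightarrow> (if exp (2 * of_real (A_N N) * z0 * rot) + 1 = 0
         then 1 / (exp (2 * of_real (A_N N) * z0 * rot) * c) else 0)) (at z0)"
    by (intro residue_lim_inverse) auto
  then show ?thesis
    by (auto simp: add_eq_0_iff2 split: if_splits)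
qed

lemma sum_summand_lim:
  fixes z0 :: complex
  assumes "t > 0"
  shows "((\<lambda>z. (z - z0) * (1 / (z ^ 2 + \<i> * of_real (t ^ 2))))
    \<longlongrightarrow> (if z0 ^ 2 + \<i> * of_real (t ^ 2) = 0 then 1 / (2 * z0) else 0)) (at z0)"
  using assms by (intro residue_lim_inverse) (auto intro!: derivative_eq_intros)

lemma F_expr_lim:
  fixes N z0
  defines "r k \<equiv> if z0 ^ 2 + \<i> * of_real ((t_k N k) ^ 2) = 0 then 1 / (2 * z0) else 0"
  shows "((\<lambda>z. (z - z0) * F_expr N z) \<longlongrightarrow>
      (if exp (2 * of_real (A_N N) * z0 * rot) + 1 = 0 then - 1 / (2 * of_real (A_N N) * rot) else 0)
      + z0 / of_real (A_N N) * exp (\<i> * (z0 ^ 2 + of_real pi / 4))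
        * (\<Sum>k = 1..N. of_real (exp (- ((t_k N k) ^ 2))) * r k)) (at z0)"
proof -
  have expand: "(z - z0) * F_expr N z =
      (z - z0) * (1 / (exp (2 * of_real (A_N N) * z * rot) + 1))
      + z / of_real (A_N N) * exp (\<i> * (z ^ 2 + of_real pi / 4))
        * (\<Sum>k = 1..N. of_real (exp (- ((t_k N k) ^ 2)))
            * ((z - z0) * (1 / (z ^ 2 + \<i> * of_real ((t_k N k) ^ 2)))))" for z
    unfolding F_expr_def by (simp add: distrib_left sum_distrib_left mult_ac)
  have "((\<lambda>z. (z - z0) * (1 / (z ^ 2 + \<i> * of_real ((t_k N k) ^ 2)))) \<longlongrightarrow> r k) (at z0)"
    if "k \<in> {1..N}" for k
    unfolding r_def using sum_summand_lim t_k_pos that by simp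
  then show ?thesis
    unfolding expand using A_N_pos[of N]
    by (intro tendsto_add exp_summand_lim tendsto_mult tendsto_sum tendsto_intros) auto
qed

text \<open>At most one term of the finite sum is singular at a given point, because \<open>t_k N k\<close> is
  injective and positive for \<open>k \<ge> 1\<close>; that term has to cancel the residue of the
  exponential summand.\<close>

lemma F_expr_residue:
  "((\<lambda>z. (z - z0) * F_expr N z) \<longlongrightarrow>
      (if z0 \<in> pole_points N then - 1 / (2 * of_real (A_N N) * rot) else 0)) (at z0)"
proof (cases "\<exists>k\<ge>1. z0 ^ 2 + \<i> * of_real ((t_k N k) ^ 2) = 0")
  case False
  then have "z0 \<notin> pole_points N"
    by (auto simp: pole_points_eq)
  moreover have "exp (2 * of_real (A_N N) * z0 * rot) + 1 \<noteq> 0"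
    using False exp_denominator_zero_iff by blast
  moreover have "(\<Sum>k = 1..N. of_real (exp (- ((t_k N k) ^ 2))) *
      (if z0 ^ 2 + \<i> * of_real ((t_k N k) ^ 2) = 0 then 1 / (2 * z0) else 0)) = 0"
    using False by (intro sum.neutral) auto
  ultimately show ?thesis
    using F_expr_lim[of z0 N] by simp
next
  case True
  then obtain j where j: "j \<ge> 1" "z0 ^ 2 + \<i> * of_real ((t_k N j) ^ 2) = 0"
    by blast
  have uniq: "z0 ^ 2 + \<i> * of_real ((t_k N k) ^ 2) = 0 \<longleftrightarrow> k = j" if "k \<ge> 1" for k
  proof
    assume "z0 ^ 2 + \<i> * of_real ((t_k N k) ^ 2) = 0"
    with j have "\<i> * complex_of_real ((t_k N k) ^ 2) = \<i> * complex_of_real ((t_k N j) ^ 2)"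
      by (metis add_left_cancel)
    then have "(t_k N k) ^ 2 = (t_k N j) ^ 2"
      unfolding mult_cancel_left of_real_eq_iff by simp
    with t_k_sq_inj that j(1) show "k = j" by blast
  qed (use j in simp)
  have E: "exp (2 * of_real (A_N N) * z0 * rot) + 1 = 0"
    using True exp_denominator_zero_iff by blast
  have pole: "z0 \<in> pole_points N \<longleftrightarrow> j \<ge> N + 1"
    unfolding pole_points_eq using uniq j by (auto simp del: of_real_power)
  have "z0 \<noteq> 0"
    using j t_k_pos[of j N] by auto
  have "(\<Sum>k = 1..N. of_real (exp (- ((t_k N k) ^ 2))) *
        (if z0 ^ 2 + \<i> * of_real ((t_k N k) ^ 2) = 0 then 1 / (2 * z0) else 0))
      = (\<Sum>k = 1..N. if k = j then of_real (exp (- ((t_k N k) ^ 2))) / (2 * z0) else 0)"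
    using uniq by (intro sum.cong) (auto simp del: of_real_power)
  also have "\<dots> = (if j \<le> N then of_real (exp (- ((t_k N j) ^ 2))) / (2 * z0) else 0)"
    using j(1) by (simp add: sum.delta)
  finally have sum: "(\<Sum>k = 1..N. of_real (exp (- ((t_k N k) ^ 2))) *
        (if z0 ^ 2 + \<i> * of_real ((t_k N k) ^ 2) = 0 then 1 / (2 * z0) else 0)) = \<dots>" .
  have "\<i> * z0 ^ 2 = of_real ((t_k N j) ^ 2)"
  proof -
    have "z0 ^ 2 = - (\<i> * of_real ((t_k N j) ^ 2))"
      using j(2) by (simp only: add_eq_0_iff2)
    then show ?thesis by simp
  qed
  then have "exp (\<i> * (z0 ^ 2 + of_real pi / 4)) = of_real (exp ((t_k N j) ^ 2)) * (1 / rot)"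
    by (simp only: distrib_left exp_add times_divide_eq_right exp_quarter_pi exp_of_real)
  then have "z0 / of_real (A_N N) * exp (\<i> * (z0 ^ 2 + of_real pi / 4))
      * (of_real (exp (- ((t_k N j) ^ 2))) / (2 * z0))
      = (of_real (exp ((t_k N j) ^ 2) * exp (- ((t_k N j) ^ 2)))) / (2 * of_real (A_N N) * rot)"
    using \<open>z0 \<noteq> 0\<close> by simp
  also have "\<dots> = 1 / (2 * of_real (A_N N) * rot)"
    by (simp flip: exp_add)
  finally have cancel: "z0 / of_real (A_N N) * exp (\<i> * (z0 ^ 2 + of_real pi / 4))
      * (of_real (exp (- ((t_k N j) ^ 2))) / (2 * z0)) = 1 / (2 * of_real (A_N N) * rot)" .
  show ?thesis
  proof (cases "j \<le> N")
    case True
    then have "z0 \<notin> pole_points N"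
      using pole by simp
    then show ?thesis
      using F_expr_lim[of z0 N] unfolding sum if_P[OF E] if_P[OF True] cancel by simp
  next
    case False
    then have "z0 \<in> pole_points N"
      using pole by simp
    then show ?thesis
      using F_expr_lim[of z0 N] unfolding sum if_P[OF E] if_not_P[OF False] by simp
  qed
qed

section \<open>Analyticity and poles of the extension\<close>

lemma F_N_analytic_at:
  assumes "z \<notin> pole_points N"
  shows "F_N N analytic_on {z}"
  unfolding F_N_def
  using remove_sings_analytic_of_lim_0[OF F_expr_meromorphic] F_expr_residue[of z N] assms by simp

lemma F_N_simple_pole:
  assumes "z \<in> pole_points N"
  shows "is_pole (F_N N) z" and "zorder (F_N N) z = -1"
proof -
  have iso: "isolated_singularity_at (F_expr N) z"
    by (rule meromorphic_on_isolated_singularity[OF F_expr_meromorphic])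
  have lim: "((\<lambda>w. (w - z) * F_expr N w) \<longlongrightarrow> - 1 / (2 * of_real (A_N N) * rot)) (at z)"
    using F_expr_residue[of z N] assms by simp
  moreover have "- 1 / (2 * of_real (A_N N) * rot) \<noteq> 0"
    using A_N_pos[of N] by simp
  ultimately show "is_pole (F_N N) z" "zorder (F_N N) z = -1"
    unfolding F_N_def using simple_pole_of_lim[OF F_expr_meromorphic lim] iso by auto
qed

lemma pole_points_location:
  assumes "z \<in> pole_points N"
  shows "Re z * Im z < 0" and "\<bar>Im z\<bar> \<ge> A_N N / sqrt 2"
proof -
  obtain k where k: "k \<ge> N + 1" "z ^ 2 + \<i> * of_real ((t_k N k) ^ 2) = 0"
    using assms by (auto simp: pole_points_eq)
  have re: "(Re z)^2 = (Im z)^2"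
    using arg_cong[OF k(2), of Re] by (simp add: power2_eq_square del: of_real_power)
  have im: "2 * (Re z * Im z) = - ((t_k N k)^2)"
    using arg_cong[OF k(2), of Im]
    by (simp add: power2_eq_square mult.commute eq_neg_iff_add_eq_0 del: of_real_power)
  have t: "t_k N k \<ge> A_N N"
    using t_k_mono[OF k(1)] by (simp add: A_N_eq_t_k)
  have "t_k N k > 0"
    using t A_N_pos[of N] by simp
  then have "(t_k N k)^2 > 0"
    by simp
  then show "Re z * Im z < 0"
    using im by linarith
  have "\<bar>Re z\<bar> = \<bar>Im z\<bar>"
    using re by (simp add: power2_eq_iff abs_eq_iff)
  then have "\<bar>Re z * Im z\<bar> = (Im z)^2"
    by (simp add: abs_mult power2_eq_square)
  then have "2 * (Im z)^2 = (t_k N k)^2"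
    using im \<open>Re z * Im z < 0\<close> by simp
  also have "\<dots> \<ge> (A_N N)^2"
    using t A_N_pos[of N] by (intro power_mono) auto
  finally have "(A_N N / sqrt 2)^2 \<le> \<bar>Im z\<bar>^2"
    by (simp add: power_divide)
  then show "\<bar>Im z\<bar> \<ge> A_N N / sqrt 2"
    by (rule power2_le_imp_le) simp
qed

theorem mainTheorem7:
  fixes N :: nat
  assumes "N \<ge> 1"
  shows "F_N N meromorphic_on UNIV
    \<and> {z. \<not> F_N N analytic_on {z}} = pole_points N
    \<and> (\<forall>z \<in> pole_points N. is_pole (F_N N) z \<and> zorder (F_N N) z = -1)
    \<and> F_N N analytic_on {z. \<bar>Im z\<bar> < A_N N / sqrt 2}
    \<and> F_N N analytic_on {z. Re z \<ge> 0 \<and> Im z \<ge> 0}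
    \<and> F_N N analytic_on {z. Re z \<le> 0 \<and> Im z \<le> 0}"
proof (intro conjI)
  show "F_N N meromorphic_on UNIV"
    unfolding F_N_def by (intro remove_sings_meromorphic F_expr_meromorphic)
  show "{z. \<not> F_N N analytic_on {z}} = pole_points N"
    using F_N_analytic_at F_N_simple_pole(1) analytic_at_imp_no_pole by blast
  show "\<forall>z \<in> pole_points N. is_pole (F_N N) z \<and> zorder (F_N N) z = -1"
    using F_N_simple_pole by blast
  have off_poles: "F_N N analytic_on S" if "\<And>z. z \<in> S \<Longrightarrow> z \<notin> pole_points N" for S
    using that F_N_analytic_at analytic_on_analytic_at by blast
  show "F_N N analytic_on {z. \<bar>Im z\<bar> < A_N N / sqrt 2}"
    by (rule off_poles) (use pole_points_location(2) in force)
  show "F_N N analytic_on {z. Re z \<ge> 0 \<and> Im z \<ge> 0}"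
    by (rule off_poles) (metis (mono_tags) mem_Collect_eq mult_nonneg_nonneg not_le
        pole_points_location(1))
  show "F_N N analytic_on {z. Re z \<le> 0 \<and> Im z \<le> 0}"
    by (rule off_poles) (metis (mono_tags) mem_Collect_eq mult_nonpos_nonpos not_le
        pole_points_location(1))
qed

end
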